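(* Let $d$ be a positive integer and $0 \leq k \leq d-1$. There exist infinite sequences of $d$-polytopes $(P_n)_n$ and $(Q_n)_n$ such that for every $\varepsilon > 0$ and all sufficiently large $n$, \[ \frac{f_k(P_n)}{f_0(P_n)} < \rho(d, k) + \varepsilon,\qquad \frac{f_k(Q_n)}{f_{d-1}(Q_n)} < \rho(d, d-k-1) + \varepsilon. \]
   Context: A $d$-polytope is a convex polytope whose affine hull has dimension $d$; $f_j(P)$ is the number of $j$-dimensional faces of $P$. For integers $0\le k<d$, \[ \rho(d,k)=\frac12\left[\binom{\lceil d/2\rceil}{k}+\binom{\lfloor d/2\rfloor}{k}\right], \] with $\binom{a}{b}=0$ if $b<0$ or $b>a$. *)

theory Defs
  imports "HOL-Analysis.Analysis"
begin

definition d_polytope :: "nat \<Rightarrow> 'a::euclidean_space set \<Rightarrow> bool" where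
  "d_polytope d P \<longleftrightarrow> polytope P \<and> aff_dim P = int d"

definition f_num :: "nat \<Rightarrow> 'a::euclidean_space set \<Rightarrow> nat" where
  "f_num j P = card {F. F face_of P \<and> aff_dim F = int j}"

definition rho :: "nat \<Rightarrow> nat \<Rightarrow> real" where
  "rho d k = 1 / 2 * (real (nat \<lceil>real d / 2\<rceil> choose k) + real (nat \<lfloor>real d / 2\<rfloor> choose k))"

end

theory Submission
  imports Defs "HOL-Computational_Algebra.Polynomial"
begin

text \<open>
  Write \<open>d = e + 2 m\<close> with \<open>e \<in> {0, 1}\<close>, and let \<open>N = n + 3\<close>. The polytopes \<open>P\<^sub>n\<close> are products (orthogonal
  Minkowski sums) of \<open>m\<close> convex \<open>N\<close>-gons, times a segment if \<open>e = 1\<close>. Nonempty faces of a product are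
  the products of nonempty faces and dimensions add, so the face numbers are the coefficients of
  \<open>(N + N t + t\<^sup>2)\<^sup>m (2 + t)\<^sup>e\<close>; divided by \<open>N\<^sup>m\<close> they tend to those of
  \<open>(1 + t)\<^sup>m (2 + t)\<^sup>e\<close>, whose quotients by the constant term are \<open>\<rho>(d, k)\<close>.

  The polytopes \<open>Q\<^sub>n\<close> are the corresponding free sums: convex hulls of the union of polygons (and a
  segment) in orthogonal subspaces, each with the origin in its relative interior. Proper faces
  (including the empty one) of a free sum are the joins of proper faces, and dimension plus one adds, so
  the limiting generating polynomial is \<open>(t + t\<^sup>2)\<^sup>m (1 + 2 t)\<^sup>e\<close>.

  The correspondences of faces are obtained by exposing faces of polytopes through linear functionals
  and adding the functionals of the two summands.
\<close>

section \<open>Growth of graded families\<close>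

text \<open>\<open>p\<close> is the limiting generating polynomial of the counts by weight. The base
  \<open>n + 3\<close> is the number of vertices of the polygons used, and \<open>m\<close> will be
  the number of polygon summands.\<close>

definition graded_growth :: "(nat \<Rightarrow> 'b set) \<Rightarrow> ('b \<Rightarrow> nat) \<Rightarrow> nat \<Rightarrow> real poly \<Rightarrow> bool" where
  "graded_growth X w m p \<longleftrightarrow> (\<forall>n. finite (X n)) \<and>
     (\<forall>j. (\<lambda>n. real (card {x \<in> X n. w x = j}) / real (n + 3) ^ m) \<longlonglongrightarrow> coeff p j)"

lemma card_graded_product:
  fixes u :: "'a \<Rightarrow> nat" and v :: "'b \<Rightarrow> nat"
  assumes "finite A" "finite B" and bij: "bij_betw \<phi> (A \<times> B) C"
    and w: "\<And>a b. a \<in> A \<Longrightarrow> b \<in> B \<Longrightarrow> w (\<phi> (a, b)) = u a + v b"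
  shows "card {c \<in> C. w c = j} =
    (\<Sum>i\<le>j. card {a \<in> A. u a = i} * card {b \<in> B. v b = j - i})"
proof -
  let ?D = "\<Union>i\<le>j. {a \<in> A. u a = i} \<times> {b \<in> B. v b = j - i}"
  have C: "C = \<phi> ` (A \<times> B)" and inj: "inj_on \<phi> (A \<times> B)"
    using bij by (auto simp: bij_betw_def)
  have "{c \<in> C. w c = j} = \<phi> ` ?D"
  proof (intro equalityI subsetI)
    fix c assume "c \<in> {c \<in> C. w c = j}"
    then obtain a b where "a \<in> A" "b \<in> B" "c = \<phi> (a, b)" "u a + v b = j"
      using w by (auto simp: C)
    then show "c \<in> \<phi> ` ?D" by (intro image_eqI[of _ _ "(a, b)"]) auto
  qed (auto simp: C w)
  moreover have "inj_on \<phi> ?D"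
    by (rule inj_on_subset[OF inj]) auto
  ultimately have "card {c \<in> C. w c = j} = card ?D"
    by (simp add: card_image)
  also have "\<dots> = (\<Sum>i\<le>j. card ({a \<in> A. u a = i} \<times> {b \<in> B. v b = j - i}))"
    using assms(1,2) by (intro card_UN_disjoint) auto
  finally show ?thesis by (simp add: card_cartesian_product)
qed

text \<open>Counts over a product are convolutions of the counts of the factors, as are the
  coefficients of \<open>p * q\<close>, and limits pass through the finite sum. The bijection will
  be the Minkowski sum of faces in one application and the join of faces in the other.\<close>

lemma graded_growth_product:
  assumes A: "graded_growth A u m p" and B: "graded_growth B v l q"
    and bij: "\<And>n. bij_betw \<phi> (A n \<times> B n) (C n)"
    and w: "\<And>n a b. a \<in> A n \<Longrightarrow> b \<in> B n \<Longrightarrow> w (\<phi> (a, b)) = u a + v b"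
  shows "graded_growth C w (m + l) (p * q)"
  unfolding graded_growth_def
proof (intro conjI allI)
  have fin: "finite (A n)" "finite (B n)" for n
    using A B by (auto simp: graded_growth_def)
  then show "finite (C n)" for n
    using bij_betw_finite[OF bij[of n]] by auto
  fix j
  let ?a = "\<lambda>i n. card {a \<in> A n. u a = i}" and ?b = "\<lambda>i n. card {b \<in> B n. v b = i}"
  have "(\<lambda>n. \<Sum>i\<le>j. (real (?a i n) / real (n + 3) ^ m) * (real (?b (j - i) n) / real (n + 3) ^ l))
      \<longlonglongrightarrow> coeff (p * q) j"
    unfolding coeff_mult using A B unfolding graded_growth_def
    by (intro tendsto_sum tendsto_mult) blast+
  moreover have "real (card {c \<in> C n. w c = j}) / real (n + 3) ^ (m + l) =
      (\<Sum>i\<le>j. (real (?a i n) / real (n + 3) ^ m) * (real (?b (j - i) n) / real (n + 3) ^ l))" for n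
  proof -
    have "card {c \<in> C n. w c = j} = (\<Sum>i\<le>j. ?a i n * ?b (j - i) n)"
      using fin bij w by (intro card_graded_product)
    then show ?thesis
      by (simp add: power_add sum_divide_distrib)
  qed
  ultimately show "(\<lambda>n. real (card {c \<in> C n. w c = j}) / real (n + 3) ^ (m + l)) \<longlonglongrightarrow> coeff (p * q) j"
    by presburger
qed

text \<open>The normalizing power cancels in the quotient; both quotients of the theorem are of this
  form.\<close>

lemma graded_growth_ratio:
  assumes "graded_growth X w m p" "coeff p a \<noteq> 0"
  shows "(\<lambda>n. real (card {x \<in> X n. w x = j}) / real (card {x \<in> X n. w x = a}))
    \<longlonglongrightarrow> coeff p j / coeff p a"
proof -
  have "(\<lambda>n. (real (card {x \<in> X n. w x = j}) / real (n + 3) ^ m) /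
      (real (card {x \<in> X n. w x = a}) / real (n + 3) ^ m)) \<longlonglongrightarrow> coeff p j / coeff p a"
    using assms unfolding graded_growth_def by (intro tendsto_divide) blast+
  moreover have "(real (card {x \<in> X n. w x = j}) / real (n + 3) ^ m) /
      (real (card {x \<in> X n. w x = a}) / real (n + 3) ^ m) =
      real (card {x \<in> X n. w x = j}) / real (card {x \<in> X n. w x = a})" for n
    by simp
  ultimately show ?thesis by (simp only:)
qed

lemma graded_growth_const:
  assumes "finite X" "\<And>j. real (card {x \<in> X. w x = j}) = coeff p j"
  shows "graded_growth (\<lambda>n. X) w 0 p"
  using assms by (simp add: graded_growth_def)

lemma growth_limits:
  "(\<lambda>n. real (n + 3) / real (n + 3) ^ 1) \<longlonglongrightarrow> 1" "(\<lambda>n. real 1 / real (n + 3) ^ 1) \<longlonglongrightarrow> 0"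
  using LIMSEQ_ignore_initial_segment[OF lim_1_over_n[where 'a = real], of 3] by simp_all

section \<open>Exposed faces and orthogonality\<close>

text \<open>Every face of a polytope is exposed, and projecting the exposing functional onto
  \<open>S\<close> does not change its values on \<open>P\<close>. With \<open>a\<close> in
  \<open>S\<close>, the functional vanishes on everything orthogonal to \<open>S\<close>.\<close>

lemma polytope_face_exposed:
  fixes P :: "'a::euclidean_space set"
  assumes "polytope P" "F face_of P" "P \<subseteq> S" "subspace S"
  obtains a b where "a \<in> S" "\<And>x. x \<in> P \<Longrightarrow> a \<bullet> x \<le> b" "F = P \<inter> {x. a \<bullet> x = b}"
proof -
  have "F exposed_face_of P"
    using assms exposed_face_of_polyhedron polytope_imp_polyhedron by blast
  then obtain a b where ab: "P \<subseteq> {x. a \<bullet> x \<le> b}" "F = P \<inter> {x. a \<bullet> x = b}"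
    by (auto simp: exposed_face_of_def)
  obtain y z where yz: "y \<in> span S" "\<And>w. w \<in> span S \<Longrightarrow> orthogonal z w" "a = y + z"
    using orthogonal_subspace_decomp_exists[of S a] by blast
  have S: "span S = S" using assms(4) by simp
  have "a \<bullet> x = y \<bullet> x" if "x \<in> P" for x
    using yz(2)[of x] yz(3) that assms(3) S by (auto simp: orthogonal_def inner_add_left)
  with ab have "\<And>x. x \<in> P \<Longrightarrow> y \<bullet> x \<le> b" "F = P \<inter> {x. y \<bullet> x = b}" by auto
  with that yz(1) S show ?thesis by blast
qed

text \<open>A face of the hull of a compact set is the hull of some part \<open>V'\<close> of that
  set, and \<open>V'\<close> must lie on the hyperplane. Compact rather than finite \<open>V\<close>
  admits the union of two polytopes.\<close>

lemma convex_hull_Int_supporting_hyperplane: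
  fixes V :: "'a::euclidean_space set"
  assumes "compact V" "\<And>x. x \<in> V \<Longrightarrow> a \<bullet> x \<le> b"
  shows "convex hull V \<inter> {x. a \<bullet> x = b} = convex hull (V \<inter> {x. a \<bullet> x = b})"
    and "convex hull (V \<inter> {x. a \<bullet> x = b}) face_of convex hull V"
proof -
  have "convex hull V \<subseteq> {x. a \<bullet> x \<le> b}"
    using assms(2) by (intro hull_minimal convex_halfspace_le) auto
  then have le: "a \<bullet> x \<le> b" if "x \<in> convex hull V" for x using that by auto
  have face: "(convex hull V \<inter> {x. a \<bullet> x = b}) face_of convex hull V"
    using le by (intro face_of_Int_supporting_hyperplane_le convex_convex_hull)
  then obtain V' where V': "V' \<subseteq> V" "convex hull V \<inter> {x. a \<bullet> x = b} = convex hull V'"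
    using face_of_convex_hull_subset[OF assms(1)] by blast
  then have "V' \<subseteq> V \<inter> {x. a \<bullet> x = b}"
    using hull_subset[of V' convex] by auto
  then have "convex hull V' \<subseteq> convex hull (V \<inter> {x. a \<bullet> x = b})" by (rule hull_mono)
  moreover have "convex hull (V \<inter> {x. a \<bullet> x = b}) \<subseteq> convex hull V \<inter> {x. a \<bullet> x = b}"
    by (intro hull_minimal convex_Int convex_convex_hull convex_hyperplane)
       (auto intro: hull_inc)
  ultimately show eq: "convex hull V \<inter> {x. a \<bullet> x = b} = convex hull (V \<inter> {x. a \<bullet> x = b})"
    using V' by auto
  show "convex hull (V \<inter> {x. a \<bullet> x = b}) face_of convex hull V"
    using face unfolding eq .
qed

definition orthogonal_sets :: "'a::real_inner set \<Rightarrow> 'a set \<Rightarrow> bool" where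
  "orthogonal_sets S T \<longleftrightarrow> (\<forall>x\<in>S. \<forall>y\<in>T. x \<bullet> y = 0)"

lemma orthogonal_setsD:
  "orthogonal_sets S T \<Longrightarrow> x \<in> S \<Longrightarrow> y \<in> T \<Longrightarrow> x \<bullet> y = 0"
  "orthogonal_sets S T \<Longrightarrow> x \<in> S \<Longrightarrow> y \<in> T \<Longrightarrow> y \<bullet> x = 0"
  by (auto simp: orthogonal_sets_def inner_commute)

lemma orthogonal_sets_add_eqD:
  assumes "subspace S" "subspace T" "orthogonal_sets S T"
    and "x \<in> S" "x' \<in> S" "y \<in> T" "y' \<in> T" "x + y = x' + y'"
  shows "x = x'" "y = y'"
proof -
  have "x - x' \<in> S" "y' - y \<in> T" using assms subspace_diff by auto
  moreover have eq: "x - x' = y' - y" using assms(8) by (simp add: algebra_simps)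
  ultimately have "(x - x') \<bullet> (x - x') = 0"
    using orthogonal_setsD(1)[OF assms(3)] by metis
  with eq show "x = x'" "y = y'" by auto
qed

text \<open>The spans meet only in 0, since a common vector is orthogonal to itself.\<close>

lemma dim_Un_orthogonal_sets:
  fixes F G :: "'a::euclidean_space set"
  assumes "subspace S" "subspace T" "orthogonal_sets S T" "F \<subseteq> S" "G \<subseteq> T"
  shows "dim (F \<union> G) = dim F + dim G"
proof -
  have "span F \<subseteq> S" "span G \<subseteq> T" using assms span_minimal by metis+
  then have "span F \<inter> span G \<subseteq> {0}"
    using assms(3) orthogonal_setsD(1) by fastforce
  then have "dim (span F \<inter> span G) = 0" by simp
  moreover have "dim (F \<union> G) = dim {x + y |x y. x \<in> span F \<and> y \<in> span G}"
    using dim_span[of "F \<union> G"] by (simp add: span_Un)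
  ultimately show ?thesis
    using dim_sums_Int[of "span F" "span G"] by (simp del: dim_eq_0)
qed

text \<open>The hyperplane misses the origin, so adjoining 0 raises the affine dimension by one and
  makes it a linear dimension. For the empty set this reads -1 + 1 = 0. It is the source of the
  additivity of the shifted dimension under joins.\<close>

lemma aff_dim_off_origin:
  fixes F :: "'a::euclidean_space set"
  assumes "\<And>x. x \<in> F \<Longrightarrow> a \<bullet> x = 1"
  shows "aff_dim F + 1 = int (dim F)"
proof -
  have "affine hull F \<subseteq> {x. a \<bullet> x = 1}"
    using assms by (intro hull_minimal affine_hyperplane) auto
  then have "aff_dim (insert 0 F) = aff_dim F + 1"
    by (auto simp: aff_dim_insert)
  moreover have "aff_dim (insert 0 F) = int (dim (insert 0 F))"
    by (intro aff_dim_zero hull_inc) simp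
  moreover have "dim (insert 0 F) = dim F"
    by (metis dim_span span_insert_0)
  ultimately show ?thesis by simp
qed

section \<open>Products\<close>

text \<open>Written as a linear image of the Cartesian product, from which it inherits being a
  polytope.\<close>

definition set_sum :: "'a::real_vector set \<Rightarrow> 'a set \<Rightarrow> 'a set" where
  "set_sum F G = (\<lambda>(x, y). x + y) ` (F \<times> G)"

lemma set_sumI: "x \<in> F \<Longrightarrow> y \<in> G \<Longrightarrow> x + y \<in> set_sum F G"
  by (force simp: set_sum_def)

lemma set_sumE:
  assumes "z \<in> set_sum F G"
  obtains x y where "x \<in> F" "y \<in> G" "z = x + y"
  using assms by (auto simp: set_sum_def)

lemma polytope_set_sum:
  fixes P Q :: "'a::euclidean_space set"
  assumes "polytope P" "polytope Q"
  shows "polytope (set_sum P Q)"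
  unfolding set_sum_def
proof (rule polytope_linear_image)
  show "linear (\<lambda>(x::'a, y). x + y)"
    by (rule linearI) (auto simp: algebra_simps)
  show "polytope (P \<times> Q)" using assms by (rule polytope_Times)
qed

text \<open>After translation both sets contain 0, so affine dimensions are linear ones, and then
  the sum and the union span the same subspace.\<close>

lemma aff_dim_set_sum_orthogonal:
  fixes F G :: "'a::euclidean_space set"
  assumes "subspace S" "subspace T" "orthogonal_sets S T" "F \<subseteq> S" "G \<subseteq> T" "F \<noteq> {}" "G \<noteq> {}"
  shows "aff_dim (set_sum F G) = aff_dim F + aff_dim G"
proof -
  obtain x y where xy: "x \<in> F" "y \<in> G" using assms by auto
  define F' G' where "F' = (+) (- x) ` F" and "G' = (+) (- y) ` G"
  have sub: "F' \<subseteq> S" "G' \<subseteq> T"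
    using assms xy by (auto simp: F'_def G'_def intro!: subspace_diff)
  have 0: "0 \<in> F'" "0 \<in> G'" using xy by (auto simp: F'_def G'_def image_iff)
  have "F' \<times> G' = (\<lambda>(u, v). (- x + u, - y + v)) ` (F \<times> G)"
    by (auto simp: F'_def G'_def)
  then have eq: "(+) (- (x + y)) ` set_sum F G = set_sum F' G'"
    by (simp add: set_sum_def image_image case_prod_unfold algebra_simps)
  have "x + 0 \<in> set_sum F' G'" "0 + y \<in> set_sum F' G'" if "x \<in> F'" "y \<in> G'" for x y
    using 0 that set_sumI by blast+
  then have "F' \<union> G' \<subseteq> set_sum F' G'"
    using 0 by auto
  moreover have "set_sum F' G' \<subseteq> span (F' \<union> G')"
    by (auto simp: set_sum_def intro: span_add[OF span_base span_base])
  ultimately have "span (set_sum F' G') = span (F' \<union> G')"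
    by (intro equalityI span_mono span_minimal subspace_span)
  then have "dim (set_sum F' G') = dim (F' \<union> G')"
    using dim_span[of "set_sum F' G'"] dim_span[of "F' \<union> G'"] by simp
  also have "\<dots> = dim F' + dim G'"
    by (rule dim_Un_orthogonal_sets[OF assms(1-3) sub])
  finally have "dim (set_sum F' G') = dim F' + dim G'" .
  moreover have "0 \<in> set_sum F' G'" using set_sumI[OF 0] by simp
  ultimately have "aff_dim (set_sum F' G') = aff_dim F' + aff_dim G'"
    using 0 by (simp add: aff_dim_zero hull_inc)
  then show ?thesis
    using aff_dim_translation_eq[of "- (x + y)" "set_sum F G"]
      aff_dim_translation_eq[of "- x" F] aff_dim_translation_eq[of "- y" G]
    unfolding eq F'_def[symmetric] G'_def[symmetric] by linarith
qed

text \<open>The maximum of a functional on a sum is the sum of its maxima, attained exactly on the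
  sum of the two maximizing faces; this gives surjectivity. Injectivity is uniqueness of orthogonal
  decompositions. Empty faces are excluded because a sum with the empty set is empty whatever the
  other summand.\<close>

lemma bij_betw_faces_set_sum:
  fixes P Q :: "'a::euclidean_space set"
  assumes P: "polytope P" "P \<subseteq> S" "subspace S" and Q: "polytope Q" "Q \<subseteq> T" "subspace T"
    and orth: "orthogonal_sets S T"
  shows "bij_betw (\<lambda>(F, G). set_sum F G)
    ({F. F face_of P \<and> F \<noteq> {}} \<times> {G. G face_of Q \<and> G \<noteq> {}})
    {H. H face_of set_sum P Q \<and> H \<noteq> {}}"
  unfolding bij_betw_def
proof
  let ?A = "{F. F face_of P \<and> F \<noteq> {}}" and ?B = "{G. G face_of Q \<and> G \<noteq> {}}"
  show "inj_on (\<lambda>(F, G). set_sum F G) (?A \<times> ?B)"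
  proof (rule inj_onI, clarify)
    fix F G F' G'
    assume face: "F face_of P" "F' face_of P" "G face_of Q" "G' face_of Q"
      and ne: "F \<noteq> {}" "F' \<noteq> {}" "G \<noteq> {}" "G' \<noteq> {}" and eq: "set_sum F G = set_sum F' G'"
    have sub: "F \<subseteq> S" "F' \<subseteq> S" "G \<subseteq> T" "G' \<subseteq> T"
      using face P Q face_of_imp_subset by blast+
    have *: "x \<in> F' \<and> y \<in> G'" if h: "x \<in> F" "y \<in> G" "set_sum F G \<subseteq> set_sum F' G'"
        "F \<subseteq> S" "F' \<subseteq> S" "G \<subseteq> T" "G' \<subseteq> T" for F F' G G' x y
    proof -
      obtain x' y' where "x' \<in> F'" "y' \<in> G'" "x + y = x' + y'"
        using set_sumI[OF h(1,2)] h(3) by (blast elim: set_sumE)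
      then show ?thesis
        using orthogonal_sets_add_eqD[OF P(3) Q(3) orth, of x x' y y'] h by (metis subsetD)
    qed
    have "F \<subseteq> F'" "G \<subseteq> G'" using *[of _ F _ G F' G'] sub eq ne by auto
    moreover have "F' \<subseteq> F" "G' \<subseteq> G" using *[of _ F' _ G' F G] sub eq ne by auto
    ultimately show "F = F' \<and> G = G'" by auto
  qed
  have "set_sum F G face_of set_sum P Q \<and> set_sum F G \<noteq> {}"
    if "F \<in> ?A" "G \<in> ?B" for F G
  proof -
    have faces: "F face_of P" "G face_of Q" and ne: "set_sum F G \<noteq> {}"
      using that by (auto simp: set_sum_def)
    obtain a b where a: "a \<in> S" "\<And>x. x \<in> P \<Longrightarrow> a \<bullet> x \<le> b" "F = P \<inter> {x. a \<bullet> x = b}"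
      using polytope_face_exposed[OF P(1) faces(1) P(2,3)] by blast
    obtain c d where c: "c \<in> T" "\<And>x. x \<in> Q \<Longrightarrow> c \<bullet> x \<le> d" "G = Q \<inter> {x. c \<bullet> x = d}"
      using polytope_face_exposed[OF Q(1) faces(2) Q(2,3)] by blast
    \<comment> \<open>The cross terms vanish: \<open>a\<close> is orthogonal to \<open>Q\<close> and
      \<open>c\<close> to \<open>P\<close>. So one functional imposes independent conditions on the
      two components.\<close>
    have eq: "(a + c) \<bullet> (x + y) = a \<bullet> x + c \<bullet> y" if "x \<in> P" "y \<in> Q" for x y
      using that orthogonal_setsD[OF orth] a(1) c(1) P(2) Q(2)
      by (simp add: inner_add_left inner_add_right subset_iff)
    have "set_sum F G = set_sum P Q \<inter> {z. (a + c) \<bullet> z = b + d}"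
    proof (intro equalityI subsetI)
      fix z assume "z \<in> set_sum P Q \<inter> {z. (a + c) \<bullet> z = b + d}"
      then obtain x y where xy: "x \<in> P" "y \<in> Q" "z = x + y" "(a + c) \<bullet> z = b + d"
        by (auto simp: set_sum_def)
      then have "a \<bullet> x = b" "c \<bullet> y = d" using eq[of x y] a(2)[of x] c(2)[of y] by auto
      with xy show "z \<in> set_sum F G" unfolding a(3) c(3) by (auto intro: set_sumI)
    qed (auto simp: set_sum_def a c eq)
    moreover have "(set_sum P Q \<inter> {z. (a + c) \<bullet> z = b + d}) face_of set_sum P Q"
    proof (rule face_of_Int_supporting_hyperplane_le)
      show "convex (set_sum P Q)"
        by (intro polytope_imp_convex polytope_set_sum P Q)
      show "(a + c) \<bullet> z \<le> b + d" if "z \<in> set_sum P Q" for z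
        using that by (auto elim!: set_sumE simp: eq intro!: add_mono a c)
    qed
    ultimately show ?thesis using ne by simp
  qed
  moreover have "H \<in> (\<lambda>(F, G). set_sum F G) ` (?A \<times> ?B)"
    if H: "H face_of set_sum P Q" "H \<noteq> {}" for H
  proof -
    obtain a b where ab: "\<And>x. x \<in> set_sum P Q \<Longrightarrow> a \<bullet> x \<le> b" "H = set_sum P Q \<inter> {x. a \<bullet> x = b}"
      using polytope_face_exposed[OF polytope_set_sum[OF P(1) Q(1)] H(1), of UNIV] by auto
    obtain x y where xy: "x \<in> P" "y \<in> Q" "a \<bullet> x + a \<bullet> y = b"
      using H(2) unfolding ab(2) by (force elim: set_sumE simp: inner_add_right)
    have le: "a \<bullet> x' + a \<bullet> y' \<le> b" if "x' \<in> P" "y' \<in> Q" for x' y'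
      using ab(1)[of "x' + y'"] that by (auto simp: inner_add_right intro: set_sumI)
    \<comment> \<open>The pair \<open>x\<close>, \<open>y\<close> attains the maximum over the sum,
      so \<open>x\<close> maximizes the functional on \<open>P\<close> and \<open>y\<close>
      maximizes it on \<open>Q\<close>.\<close>
    define F G where "F = P \<inter> {z. a \<bullet> z = a \<bullet> x}" and "G = Q \<inter> {z. a \<bullet> z = a \<bullet> y}"
    have leP: "a \<bullet> z \<le> a \<bullet> x" if "z \<in> P" for z using le[OF that xy(2)] xy(3) by simp
    have leQ: "a \<bullet> z \<le> a \<bullet> y" if "z \<in> Q" for z using le[OF xy(1) that] xy(3) by simp
    have "F face_of P" "G face_of Q" unfolding F_def G_def
      using P Q leP leQ polytope_imp_convex by (auto intro!: face_of_Int_supporting_hyperplane_le)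
    moreover have "F \<noteq> {}" "G \<noteq> {}" using xy by (auto simp: F_def G_def)
    moreover have "H = set_sum F G"
    proof (intro equalityI subsetI)
      fix z assume "z \<in> H"
      then obtain x' y' where z: "x' \<in> P" "y' \<in> Q" "z = x' + y'" "a \<bullet> x' + a \<bullet> y' = b"
        unfolding ab(2) by (auto simp: set_sum_def inner_add_right)
      then have "x' \<in> F" "y' \<in> G"
        using leP[of x'] leQ[of y'] xy(3) by (auto simp: F_def G_def)
      with z show "z \<in> set_sum F G" by (auto intro: set_sumI)
    qed (use xy in \<open>auto simp: ab(2) F_def G_def set_sum_def inner_add_right\<close>)
    ultimately show ?thesis by (intro image_eqI[of _ _ "(F, G)"]) auto
  qed
  ultimately show "(\<lambda>(F, G). set_sum F G) ` (?A \<times> ?B) = {H. H face_of set_sum P Q \<and> H \<noteq> {}}"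
    by (intro equalityI subsetI) auto
qed

section \<open>Free sums\<close>

text \<open>
  Equivalent, for polytopes, to the origin lying in the relative interior, but immediate to verify for
  free sums.
\<close>

definition centered :: "'a::real_vector set \<Rightarrow> bool" where
  "centered P \<longleftrightarrow> 0 \<in> P \<and> (\<forall>F. F face_of P \<and> 0 \<in> F \<longrightarrow> F = P)"

text \<open>A proper face misses the origin, so its supporting level is positive and can be scaled
  to 1. A common level is what allows functionals of two summands to be combined.\<close>

lemma centered_proper_face_exposed:
  fixes P :: "'a::euclidean_space set"
  assumes "polytope P" "centered P" "F face_of P" "F \<noteq> P" "P \<subseteq> S" "subspace S"
  obtains a where "a \<in> S" "\<And>x. x \<in> P \<Longrightarrow> a \<bullet> x \<le> 1" "F = P \<inter> {x. a \<bullet> x = 1}"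
proof -
  obtain a b where a: "a \<in> S" "\<And>x. x \<in> P \<Longrightarrow> a \<bullet> x \<le> b" "F = P \<inter> {x. a \<bullet> x = b}"
    using polytope_face_exposed[OF assms(1,3,5,6)] by blast
  have "0 \<in> P" "0 \<notin> F" using assms(2-4) by (auto simp: centered_def)
  with a(2)[of 0] a(3) have b: "b > 0" by auto
  show ?thesis
  proof
    show "(1 / b) *\<^sub>R a \<in> S" using a(1) assms(6) by (rule subspace_scale[rotated])
  qed (use a b in auto)
qed

text \<open>By orthogonality \<open>a + c\<close> acts as \<open>a\<close> on \<open>P\<close> and
  as \<open>c\<close> on \<open>Q\<close>, so at level 1 it supports the union exactly along the two
  faces. The join is therefore a slice of the free sum, and intersecting it with \<open>P\<close>
  and \<open>Q\<close> recovers its two parts.\<close>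

lemma proper_face_free_sum:
  fixes P Q :: "'a::euclidean_space set"
  assumes P: "polytope P" "P \<subseteq> S" "subspace S" "centered P"
    and Q: "polytope Q" "Q \<subseteq> T" "subspace T" "centered Q"
    and orth: "orthogonal_sets S T"
    and faces: "F face_of P" "F \<noteq> P" "G face_of Q" "G \<noteq> Q"
  shows "convex hull (F \<union> G) face_of convex hull (P \<union> Q)"
    and "convex hull (F \<union> G) \<inter> P = F" "convex hull (F \<union> G) \<inter> Q = G"
    and "aff_dim (convex hull (F \<union> G)) + 1 = (aff_dim F + 1) + (aff_dim G + 1)"
proof -
  obtain a where a: "a \<in> S" "\<And>x. x \<in> P \<Longrightarrow> a \<bullet> x \<le> 1" "F = P \<inter> {x. a \<bullet> x = 1}"
    using centered_proper_face_exposed[OF P(1,4) faces(1,2) P(2,3)] by blast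
  obtain c where c: "c \<in> T" "\<And>x. x \<in> Q \<Longrightarrow> c \<bullet> x \<le> 1" "G = Q \<inter> {x. c \<bullet> x = 1}"
    using centered_proper_face_exposed[OF Q(1,4) faces(3,4) Q(2,3)] by blast
  have eq: "x \<in> P \<Longrightarrow> (a + c) \<bullet> x = a \<bullet> x" "x \<in> Q \<Longrightarrow> (a + c) \<bullet> x = c \<bullet> x" for x
    using orthogonal_setsD[OF orth] a(1) c(1) P(2) Q(2) by (auto simp: inner_add_left subset_iff)
  have comp: "compact (P \<union> Q)"
    using P(1) Q(1) by (simp add: compact_Un polytope_imp_compact)
  have le: "(a + c) \<bullet> x \<le> 1" if "x \<in> P \<union> Q" for x
    using that a(2) c(2) eq by auto
  have FG: "(P \<union> Q) \<inter> {x. (a + c) \<bullet> x = 1} = F \<union> G"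
    using a c eq by auto
  note hull = convex_hull_Int_supporting_hyperplane[OF comp le, unfolded FG]
  show "convex hull (F \<union> G) face_of convex hull (P \<union> Q)" by (rule hull(2))
  have "P \<subseteq> convex hull (P \<union> Q)" "Q \<subseteq> convex hull (P \<union> Q)"
    using hull_subset[of "P \<union> Q" convex] by auto
  then have "convex hull (F \<union> G) \<inter> P = P \<inter> {x. (a + c) \<bullet> x = 1}"
    "convex hull (F \<union> G) \<inter> Q = Q \<inter> {x. (a + c) \<bullet> x = 1}"
    using hull(1) by blast+
  then show "convex hull (F \<union> G) \<inter> P = F" "convex hull (F \<union> G) \<inter> Q = G"
    using eq a(3) c(3) by auto
  have "aff_dim (F \<union> G) + 1 = int (dim (F \<union> G))"
    by (rule aff_dim_off_origin[of _ "a + c"]) (use FG in auto)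
  also have "dim (F \<union> G) = dim F + dim G"
    using P(2) Q(2) a(3) c(3) by (intro dim_Un_orthogonal_sets[OF P(3) Q(3) orth]) auto
  also have "int \<dots> = (aff_dim F + 1) + (aff_dim G + 1)"
    using aff_dim_off_origin[of F a] aff_dim_off_origin[of G c] a(3) c(3) by simp
  finally show "aff_dim (convex hull (F \<union> G)) + 1 = (aff_dim F + 1) + (aff_dim G + 1)"
    by (simp add: aff_dim_convex_hull)
qed

text \<open>A face of the free sum through the origin meets \<open>P\<close> and \<open>Q\<close> in
  faces through the origin, hence contains both of them and their hull.\<close>

lemma free_sum:
  fixes P Q :: "'a::euclidean_space set"
  assumes "polytope P" "polytope Q"
  shows polytope_free_sum: "polytope (convex hull (P \<union> Q))"
    and centered_free_sum: "centered P \<Longrightarrow> centered Q \<Longrightarrow> centered (convex hull (P \<union> Q))"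
proof -
  obtain V W where "finite V" "finite W" "P = convex hull V" "Q = convex hull W"
    using assms by (auto simp: polytope_def)
  then have "convex hull (P \<union> Q) = convex hull (V \<union> W)" "finite (V \<union> W)"
    using hull_Un[of convex V W, OF convex_Inter] by auto
  then show "polytope (convex hull (P \<union> Q))"
    by (simp add: polytope_convex_hull)
  assume cent: "centered P" "centered Q"
  have sub: "P \<subseteq> convex hull (P \<union> Q)" "Q \<subseteq> convex hull (P \<union> Q)"
    using hull_subset[of "P \<union> Q" convex] by auto
  have "H = convex hull (P \<union> Q)" if H: "H face_of convex hull (P \<union> Q)" "0 \<in> H" for H
  proof -
    have "(H \<inter> P) face_of (convex hull (P \<union> Q) \<inter> P)" "(H \<inter> Q) face_of (convex hull (P \<union> Q) \<inter> Q)"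
      using H assms polytope_imp_convex by (auto intro!: face_of_slice)
    then have "H \<inter> P face_of P" "H \<inter> Q face_of Q" using sub by (simp_all add: Int_absorb1)
    then have "H \<inter> P = P" "H \<inter> Q = Q" using cent H by (auto simp: centered_def)
    then have "convex hull (P \<union> Q) \<subseteq> H"
      using H face_of_imp_convex by (intro hull_minimal) auto
    then show ?thesis using H face_of_imp_subset by blast
  qed
  then show "centered (convex hull (P \<union> Q))"
    using cent sub by (auto simp: centered_def)
qed

text \<open>Injectivity follows by intersecting a join with \<open>P\<close> and \<open>Q\<close>.
  Conversely, a functional cutting out a proper face at level 1 cuts out faces of \<open>P\<close>
  and \<open>Q\<close> at the same level, and by the hull lemma their join is the given
  face.\<close>

lemma bij_betw_faces_free_sum:
  fixes P Q :: "'a::euclidean_space set"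
  assumes P: "polytope P" "P \<subseteq> S" "subspace S" "centered P"
    and Q: "polytope Q" "Q \<subseteq> T" "subspace T" "centered Q"
    and orth: "orthogonal_sets S T"
  shows "bij_betw (\<lambda>(F, G). convex hull (F \<union> G))
    ({F. F face_of P \<and> F \<noteq> P} \<times> {G. G face_of Q \<and> G \<noteq> Q})
    {H. H face_of convex hull (P \<union> Q) \<and> H \<noteq> convex hull (P \<union> Q)}"
  unfolding bij_betw_def
proof
  let ?A = "{F. F face_of P \<and> F \<noteq> P}" and ?B = "{G. G face_of Q \<and> G \<noteq> Q}"
  let ?R = "convex hull (P \<union> Q)"
  note face = proper_face_free_sum[OF P Q orth]
  have sub: "P \<subseteq> ?R" "Q \<subseteq> ?R"
    using hull_subset[of "P \<union> Q" convex] by auto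
  show "inj_on (\<lambda>(F, G). convex hull (F \<union> G)) (?A \<times> ?B)"
  proof (rule inj_onI, clarify)
    fix F G F' G'
    assume "F face_of P" "F \<noteq> P" "F' face_of P" "F' \<noteq> P" "G face_of Q" "G \<noteq> Q"
      "G' face_of Q" "G' \<noteq> Q" and eq: "convex hull (F \<union> G) = convex hull (F' \<union> G')"
    then show "F = F' \<and> G = G'"
      using face(2,3)[of F G] face(2,3)[of F' G'] by simp
  qed
  have "convex hull (F \<union> G) face_of ?R \<and> convex hull (F \<union> G) \<noteq> ?R" if "F \<in> ?A" "G \<in> ?B" for F G
    using face(1,2)[of F G] that sub by auto
  moreover have "H \<in> (\<lambda>(F, G). convex hull (F \<union> G)) ` (?A \<times> ?B)"
    if H: "H face_of ?R" "H \<noteq> ?R" for H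
  proof -
    obtain a where a: "\<And>x. x \<in> ?R \<Longrightarrow> a \<bullet> x \<le> 1" "H = ?R \<inter> {x. a \<bullet> x = 1}"
      using centered_proper_face_exposed[OF polytope_free_sum[OF P(1) Q(1)]
        centered_free_sum[OF P(1) Q(1) P(4) Q(4)] H, of UNIV] by auto
    define F G where "F = P \<inter> {z. a \<bullet> z = 1}" and "G = Q \<inter> {z. a \<bullet> z = 1}"
    have "F face_of P" "G face_of Q" unfolding F_def G_def
      using P Q sub a(1) polytope_imp_convex by (auto intro!: face_of_Int_supporting_hyperplane_le)
    \<comment> \<open>The origin has level 0, so the faces at level 1 are proper.\<close>
    moreover have "0 \<in> P" "0 \<in> Q" "0 \<notin> F" "0 \<notin> G"
      using P(4) Q(4) by (auto simp: centered_def F_def G_def)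
    moreover have "H = convex hull ((P \<union> Q) \<inter> {x. a \<bullet> x = 1})"
      unfolding a(2) using P(1) Q(1) a(1) sub
      by (intro convex_hull_Int_supporting_hyperplane(1)) (auto intro: compact_Un polytope_imp_compact)
    then have "H = convex hull (F \<union> G)"
      by (simp add: F_def G_def Int_Un_distrib2)
    ultimately show ?thesis by (intro image_eqI[of _ _ "(F, G)"]) auto
  qed
  ultimately show "(\<lambda>(F, G). convex hull (F \<union> G)) ` (?A \<times> ?B) = {H. H face_of ?R \<and> H \<noteq> ?R}"
    by (intro equalityI subsetI) (auto simp del: Un_iff)
qed

lemma aff_dim_free_sum:
  fixes P Q :: "'a::euclidean_space set"
  assumes "P \<subseteq> S" "subspace S" "0 \<in> P" "Q \<subseteq> T" "subspace T" "0 \<in> Q" "orthogonal_sets S T"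
  shows "aff_dim (convex hull (P \<union> Q)) = aff_dim P + aff_dim Q"
  using dim_Un_orthogonal_sets[OF assms(2,5,7,1,4)] assms
  by (simp add: aff_dim_convex_hull aff_dim_zero hull_inc)

section \<open>Polygons\<close>

text \<open>
  With vertices on a parabola, the values of a linear functional at the vertices are the values of a
  quadratic polynomial at \<open>0, \<dots>, n + 2\<close>, so faces are read off from the roots of quadratics.
\<close>

locale parabolic_polygon =
  fixes e f :: "'a::euclidean_space" and n :: nat
  assumes ee: "e \<bullet> e = 1" and ff: "f \<bullet> f = 1" and ef: "e \<bullet> f = 0"
begin

definition vertex :: "nat \<Rightarrow> 'a" where
  "vertex i = real i *\<^sub>R e + (real i)\<^sup>2 *\<^sub>R f"

definition vertices :: "'a set" where
  "vertices = vertex ` {..<n + 3}"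

text \<open>Each edge occurs once, smaller index first; \<open>(0, n + 2)\<close> is the chord
  closing the arc of the parabola.\<close>

definition edges :: "(nat \<times> nat) set" where
  "edges = insert (0, n + 2) ((\<lambda>i. (i, Suc i)) ` {..<n + 2})"

lemma inner_vertex: "a \<bullet> vertex i = real i * (a \<bullet> e) + (real i)\<^sup>2 * (a \<bullet> f)"
  by (simp add: vertex_def inner_add_right)

lemma inj_vertex: "inj vertex"
proof (rule injI)
  fix i j assume "vertex i = vertex j"
  then have "e \<bullet> vertex i = e \<bullet> vertex j" by simp
  then show "i = j" by (simp add: inner_vertex ee ef)
qed

lemma finite_vertices: "finite vertices"
  by (simp add: vertices_def)

lemma aff_dim_vertices: "aff_dim vertices = 2"
proof -
  have v: "vertex 0 \<in> vertices" "vertex 1 \<in> vertices" "vertex 2 \<in> vertices"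
    by (auto simp: vertices_def)
  \<comment> \<open>These combinations solve \<open>vertex 1 = e + f\<close> and
    \<open>vertex 2 = 2 e + 4 f\<close> for \<open>e\<close> and \<open>f\<close>.\<close>
  have "(2 *\<^sub>R vertex 1 - (1/2) *\<^sub>R vertex 2) \<in> span vertices"
    "(1/2) *\<^sub>R vertex 2 - vertex 1 \<in> span vertices"
    by (intro span_diff span_scale span_base v)+
  moreover have "2 *\<^sub>R vertex 1 - (1/2) *\<^sub>R vertex 2 = e" "(1/2) *\<^sub>R vertex 2 - vertex 1 = f"
    by (simp_all add: vertex_def algebra_simps) (simp_all add: scaleR_2)
  ultimately have "{e, f} \<subseteq> span vertices" by auto
  moreover have "vertex i \<in> span {e, f}" for i
    unfolding vertex_def by (intro span_add span_scale span_base) auto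
  then have "vertices \<subseteq> span {e, f}"
    by (auto simp: vertices_def)
  ultimately have "span vertices = span {e, f}"
    by (intro equalityI span_minimal subspace_span)
  then have "dim vertices = dim {e, f}"
    using dim_span[of vertices] dim_span[of "{e, f}"] by simp
  moreover have "pairwise orthogonal {e, f}" "0 \<notin> {e, f}" "e \<noteq> f"
    using ee ff ef by (auto simp: pairwise_def orthogonal_def inner_commute)
  then have "dim {e, f} = 2"
    by (simp add: dim_eq_card_independent pairwise_orthogonal_independent)
  moreover have "0 \<in> affine hull vertices"
    using hull_inc[OF v(1)] by (simp add: vertex_def)
  ultimately show ?thesis by (simp add: aff_dim_zero)
qed

text \<open>\<open>g\<close> is the slack of the functional given by \<open>p\<close> and
  \<open>q\<close>. Exhibiting a face thus reduces to writing down a quadratic that is nonnegative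
  on the indices and vanishes exactly on \<open>I\<close>.\<close>

lemma exposed_vertices_face:
  assumes slack: "\<And>j. b - (real j * p + (real j)\<^sup>2 * q) = g j"
    and nonneg: "\<And>j. j < n + 3 \<Longrightarrow> 0 \<le> g j"
    and I: "\<And>j. j < n + 3 \<and> g j = 0 \<longleftrightarrow> j \<in> I"
  shows "convex hull (vertex ` I) face_of convex hull vertices"
proof -
  let ?a = "p *\<^sub>R e + q *\<^sub>R f"
  have "?a \<bullet> vertex j = real j * p + (real j)\<^sup>2 * q" for j
    using ee ff ef inner_commute[of f e] by (simp add: inner_vertex inner_add_left)
  then have a: "?a \<bullet> vertex j = b - g j" for j
    by (simp flip: slack)
  have "I = {j. j < n + 3 \<and> g j = 0}"
    unfolding I by simp
  then have "vertices \<inter> {x. ?a \<bullet> x = b} = vertex ` I"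
    by (auto simp: vertices_def a)
  moreover have "?a \<bullet> x \<le> b" if "x \<in> vertices" for x
    using that nonneg by (auto simp: vertices_def a)
  ultimately show ?thesis
    using convex_hull_Int_supporting_hyperplane(2)[of vertices ?a b] finite_vertices
    by (simp add: finite_imp_compact)
qed

lemma zero_dim_faces:
  "{F. F face_of convex hull vertices \<and> aff_dim F = 0} = (\<lambda>i. {vertex i}) ` {..<n + 3}"
proof (intro equalityI subsetI)
  fix F assume "F \<in> {F. F face_of convex hull vertices \<and> aff_dim F = 0}"
  then obtain x where "F = {x}" "{x} face_of convex hull vertices"
    by (auto simp: aff_dim_eq_0)
  then show "F \<in> (\<lambda>i. {vertex i}) ` {..<n + 3}"
    using extreme_point_of_convex_hull[of x vertices]
    by (auto simp: face_of_singleton vertices_def)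
next
  fix F assume "F \<in> (\<lambda>i. {vertex i}) ` {..<n + 3}"
  then obtain i where i: "i < n + 3" "F = {vertex i}" by auto
  \<comment> \<open>The tangent to the parabola at \<open>vertex i\<close> has slack with a double
    root at \<open>i\<close>.\<close>
  have slack: "(real i)\<^sup>2 - (real j * (2 * real i) + (real j)\<^sup>2 * (- 1)) = (real j - real i)\<^sup>2" for j
    by (simp add: power2_eq_square algebra_simps)
  have "convex hull (vertex ` {i}) face_of convex hull vertices"
    by (rule exposed_vertices_face[OF slack]) (use i in auto)
  then show "F \<in> {F. F face_of convex hull vertices \<and> aff_dim F = 0}" by (simp add: i)
qed

text \<open>An edge corresponds to a quadratic slack with two roots among the indices. Such a slack
  is determined up to a factor, and nonnegativity at the remaining indices forces the roots to be
  consecutive or to be the two extreme indices.\<close>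

lemma one_dim_faces:
  "{F. F face_of convex hull vertices \<and> aff_dim F = 1} =
    (\<lambda>(i, j). convex hull {vertex i, vertex j}) ` edges"
proof (intro equalityI subsetI)
  fix F assume "F \<in> (\<lambda>(i, j). convex hull {vertex i, vertex j}) ` edges"
  then consider i where "i < n + 2" "F = convex hull (vertex ` {i, Suc i})"
    | "F = convex hull (vertex ` {0, n + 2})"
    by (auto simp: edges_def)
  then show "F \<in> {F. F face_of convex hull vertices \<and> aff_dim F = 1}"
  proof cases
    case 1
    have slack: "real i * (real i + 1) - (real j * (2 * real i + 1) + (real j)\<^sup>2 * (- 1)) =
        (real j - real i) * (real j - (real i + 1))" for j
      by (simp add: power2_eq_square algebra_simps)
    \<comment> \<open>The product is negative only strictly between \<open>i\<close> and
      \<open>i + 1\<close>, where there is no integer.\<close>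
    have nonneg: "(real j - real i) * (real j - (real i + 1)) \<ge> 0" for j
      by (cases "j \<le> i") (auto intro: mult_nonpos_nonpos mult_nonneg_nonneg)
    have "F face_of convex hull vertices" unfolding 1(2)
      by (rule exposed_vertices_face[OF slack nonneg]) (use 1(1) in auto)
    then show ?thesis
      using 1 by (simp add: aff_dim_convex_hull inj_eq[OF inj_vertex])
  next
    case 2
    have slack: "0 - (real j * (- real (n + 2)) + (real j)\<^sup>2 * 1) = real j * (real (n + 2) - real j)" for j
      by (simp add: power2_eq_square algebra_simps)
    have "F face_of convex hull vertices" unfolding 2
      by (rule exposed_vertices_face[OF slack]) auto
    then show ?thesis
      using 2 by (simp add: aff_dim_convex_hull inj_eq[OF inj_vertex])
  qed
next
  fix F assume "F \<in> {F. F face_of convex hull vertices \<and> aff_dim F = 1}"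
  then have F: "F face_of convex hull vertices" "aff_dim F = 1" by auto
  obtain a b where a: "\<And>x. x \<in> convex hull vertices \<Longrightarrow> a \<bullet> x \<le> b"
      "F = convex hull vertices \<inter> {x. a \<bullet> x = b}"
    using polytope_face_exposed[OF polytope_convex_hull[OF finite_vertices] F(1), of UNIV] by auto
  define p q where "p = a \<bullet> e" and "q = a \<bullet> f"
  define I where "I = {j. j < n + 3 \<and> real j * p + (real j)\<^sup>2 * q = b}"
  have le: "real j * p + (real j)\<^sup>2 * q \<le> b" if "j < n + 3" for j
    using a(1)[of "vertex j"] that
    by (auto simp: vertices_def inner_vertex p_def q_def intro: hull_inc)
  have "vertices \<inter> {x. a \<bullet> x = b} = vertex ` I"
    by (auto simp: vertices_def I_def inner_vertex p_def q_def)
  then have FI: "F = convex hull (vertex ` I)"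
    using convex_hull_Int_supporting_hyperplane(1)[of vertices a b] finite_vertices a
    by (auto simp: finite_imp_compact hull_inc)
  \<comment> \<open>A one-dimensional face cannot be the hull of at most one vertex, so
    \<open>I\<close> has two distinct members.\<close>
  have "\<not> vertex ` I \<subseteq> {vertex i}" for i
    using aff_dim_subset[of "vertex ` I" "{vertex i}"] F(2) by (auto simp: FI aff_dim_convex_hull)
  then have "\<exists>l\<in>I. l \<noteq> k" for k by (metis image_subset_iff singletonI)
  then obtain k l where "k \<in> I" "l \<in> I" "k \<noteq> l" by blast
  then obtain i j where ij: "i \<in> I" "j \<in> I" "i < j" by (cases k l rule: linorder_cases) auto
  then have b: "real i * p + (real i)\<^sup>2 * q = b" "real j * p + (real j)\<^sup>2 * q = b" "j < n + 3"
    by (auto simp: I_def)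
  then have "(real j - real i) * (p + (real i + real j) * q) = 0"
    by (simp add: power2_eq_square algebra_simps)
  then have "p + (real i + real j) * q = 0" using ij by simp
  then have p: "p = - (real i + real j) * q" by (simp add: algebra_simps)
  have b': "b = - real i * real j * q"
    using b(1) by (simp add: p power2_eq_square algebra_simps)
  \<comment> \<open>The slack factors over its two roots \<open>i\<close> and \<open>j\<close>, with
    leading coefficient \<open>- q\<close>.\<close>
  have eq: "b - (real k * p + (real k)\<^sup>2 * q) = - q * ((real k - real i) * (real k - real j))" for k
    unfolding p b' by (simp add: power2_eq_square algebra_simps)
  have sign: "q * ((real k - real i) * (real k - real j)) \<le> 0" if "k < n + 3" for k
    using le[OF that] eq[of k] by simp
  \<comment> \<open>Otherwise the functional is constant on the vertices and the face is the whole
    polygon, of dimension 2.\<close>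
  have "q \<noteq> 0"
  proof
    assume "q = 0"
    then have "I = {..<n + 3}" using p b' by (auto simp: I_def)
    then have "aff_dim F = 2" using aff_dim_vertices by (simp add: FI aff_dim_convex_hull vertices_def)
    with F(2) show False by simp
  qed
  have "k = i \<or> k = j" if "k \<in> I" for k
    using eq[of k] that \<open>q \<noteq> 0\<close> by (auto simp: I_def)
  with ij have I: "I = {i, j}" by auto
  have "(i, j) \<in> edges"
  proof (cases "q > 0")
    case True
    \<comment> \<open>For positive \<open>q\<close> the slack is negative outside the roots, so
      testing the first and the last index forces both roots to be extreme.\<close>
    have "real i * real j \<le> 0" using sign[of 0] True by (simp add: mult_le_0_iff)
    with ij have i: "i = 0" by (simp add: mult_le_0_iff)
    have "(real (n + 2) - real i) * (real (n + 2) - real j) \<le> 0"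
      using sign[of "n + 2"] True by (simp add: mult_le_0_iff)
    with i b(3) have "j = n + 2" by (simp add: mult_le_0_iff)
    with i show ?thesis by (simp add: edges_def)
  next
    case False
    have "j = Suc i"
    proof (rule ccontr)
      assume "j \<noteq> Suc i"
      with ij have j: "Suc i < j" by simp
      \<comment> \<open>For negative \<open>q\<close> the slack is negative between the roots, so no
        index can lie there.\<close>
      then have "(real (Suc i) - real i) * (real (Suc i) - real j) < 0"
        by (intro mult_pos_neg) auto
      moreover have "q < 0" using False \<open>q \<noteq> 0\<close> by simp
      ultimately have "q * ((real (Suc i) - real i) * (real (Suc i) - real j)) > 0"
        by (rule mult_neg_neg[rotated])
      with sign[of "Suc i"] j b(3) show False by simp
    qed
    with b(3) show ?thesis by (auto simp: edges_def)
  qed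
  then show "F \<in> (\<lambda>(i, j). convex hull {vertex i, vertex j}) ` edges"
    by (intro image_eqI[of _ _ "(i, j)"]) (simp_all add: FI I)
qed

lemma card_zero_dim_faces: "card {F. F face_of convex hull vertices \<and> aff_dim F = 0} = n + 3"
  unfolding zero_dim_faces by (subst card_image) (auto intro!: inj_onI dest: injD[OF inj_vertex])

lemma card_one_dim_faces: "card {F. F face_of convex hull vertices \<and> aff_dim F = 1} = n + 3"
proof -
  have "inj_on (\<lambda>(i, j). convex hull {vertex i, vertex j}) edges"
  proof (rule inj_onI, clarify)
    fix i j i' j'
    assume "(i, j) \<in> edges" "(i', j') \<in> edges"
      and eq: "convex hull {vertex i, vertex j} = convex hull {vertex i', vertex j'}"
    then have "i < j" "i' < j'" by (auto simp: edges_def)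
    moreover have "{vertex i, vertex j} = {vertex i', vertex j'}"
      using eq by (simp add: closed_segment_eq flip: segment_convex_hull)
    then have "{i, j} = {i', j'}"
      by (simp add: doubleton_eq_iff inj_eq[OF inj_vertex])
    ultimately show "i = i' \<and> j = j'" by (auto simp: doubleton_eq_iff)
  qed
  moreover have "card edges = n + 3"
    unfolding edges_def by (subst card_insert_disjoint) (auto simp: card_image inj_on_def)
  ultimately show ?thesis
    unfolding one_dim_faces by (simp add: card_image)
qed

end

section \<open>Centered polygons inside a given plane\<close>

lemma centered_translation:
  fixes P :: "'a::euclidean_space set"
  assumes "c \<in> rel_interior P"
  shows "centered ((+) (- c) ` P)"
proof -
  have c: "c \<in> P" using assms rel_interior_subset by blast
  have "0 \<in> rel_interior ((+) (- c) ` P)"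
    unfolding rel_interior_translation using assms by (auto simp: image_iff)
  \<comment> \<open>A proper face is disjoint from the relative interior.\<close>
  then have "F = (+) (- c) ` P" if "F face_of (+) (- c) ` P" "0 \<in> F" for F
    using face_of_disjoint_rel_interior[OF that(1)] that(2) by blast
  moreover have "0 \<in> (+) (- c) ` P" using c by (auto simp: image_iff)
  ultimately show ?thesis by (simp add: centered_def)
qed

lemma card_faces_translation:
  "card {F. F face_of (+) c ` P \<and> aff_dim F = k} = card {F. F face_of P \<and> aff_dim F = k}"
  for P :: "'a::euclidean_space set"
proof -
  have "bij_betw ((`) ((+) c)) {F. F face_of P \<and> aff_dim F = k} {F. F face_of (+) c ` P \<and> aff_dim F = k}"
  proof (rule bij_betw_byWitness[where f' = "(`) ((+) (- c))"])
    show "(`) ((+) (- c)) ` {F. F face_of (+) c ` P \<and> aff_dim F = k} \<subseteq> {F. F face_of P \<and> aff_dim F = k}"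
    proof clarify
      fix F assume F: "F face_of (+) c ` P"
      then have "(+) (- c) ` F face_of (+) (- c) ` (+) c ` P" by (simp only: face_of_translation_eq)
      then show "(+) (- c) ` F face_of P \<and> aff_dim ((+) (- c) ` F) = aff_dim F"
        unfolding aff_dim_translation_eq by (simp add: image_image)
    qed
  qed (auto simp: image_image aff_dim_translation_eq)
  from bij_betw_same_card[OF this] show ?thesis by simp
qed

lemma polygon_exists:
  fixes T :: "'a::euclidean_space set"
  assumes "subspace T" "dim T = 2"
  obtains P where "polytope P" "P \<subseteq> T" "aff_dim P = 2" "centered P"
    "card {F. F face_of P \<and> aff_dim F = 0} = n + 3" "card {F. F face_of P \<and> aff_dim F = 1} = n + 3"
proof -
  obtain B where B: "B \<subseteq> T" "pairwise orthogonal B" "\<And>x. x \<in> B \<Longrightarrow> norm x = 1"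
      "independent B" "card B = dim T" "span B = T"
    by (rule orthonormal_basis_subspace[OF assms(1)]) blast
  obtain e f where Bef: "B = {e, f}" "e \<noteq> f"
    using B(5) assms(2) by (auto simp: card_2_iff)
  interpret parabolic_polygon e f n
    using B Bef by unfold_locales (auto simp: pairwise_def orthogonal_def norm_eq_1)
  let ?P = "convex hull vertices"
  have sub: "?P \<subseteq> T"
  proof (rule hull_minimal)
    have "e \<in> T" "f \<in> T" using B(1) by (auto simp: Bef(1))
    then show "vertices \<subseteq> T"
      using assms(1) by (auto simp: vertices_def vertex_def intro!: subspace_add subspace_scale)
  qed (rule subspace_imp_convex[OF assms(1)])
  \<comment> \<open>The origin is \<open>vertex 0\<close>, hence an extreme point of the polygon; a
    relative interior point \<open>c\<close> is moved there instead, and \<open>c\<close> in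
    \<open>T\<close> keeps the translate inside \<open>T\<close>.\<close>
  have "?P \<noteq> {}" using aff_dim_vertices by auto
  then obtain c where c: "c \<in> rel_interior ?P"
    using rel_interior_eq_empty[OF convex_convex_hull] by blast
  then have "c \<in> T" using rel_interior_subset sub by blast
  show ?thesis
  proof (rule that[of "(+) (- c) ` ?P"])
    show "polytope ((+) (- c) ` ?P)"
      by (simp only: polytope_translation_eq polytope_convex_hull[OF finite_vertices])
    show "(+) (- c) ` ?P \<subseteq> T"
      using sub \<open>c \<in> T\<close> assms(1) by (auto intro!: subspace_diff)
    show "aff_dim ((+) (- c) ` ?P) = 2"
      by (simp only: aff_dim_translation_eq aff_dim_convex_hull aff_dim_vertices)
    show "centered ((+) (- c) ` ?P)" by (rule centered_translation[OF c])
  qed (simp_all only: card_faces_translation card_zero_dim_faces card_one_dim_faces)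
qed

section \<open>Asymptotics of face numbers\<close>

definition nonempty_faces :: "'a::euclidean_space set \<Rightarrow> 'a set set" where
  "nonempty_faces P = {F. F face_of P \<and> F \<noteq> {}}"

text \<open>The empty face belongs to this family; in the grading by \<open>aff_dim F + 1\<close> it
  supplies the constant term.\<close>

definition proper_faces :: "'a::euclidean_space set \<Rightarrow> 'a set set" where
  "proper_faces P = {F. F face_of P \<and> F \<noteq> P}"

lemma card_nonempty_faces: "card {F \<in> nonempty_faces P. nat (aff_dim F) = j} = f_num j P"
proof -
  \<comment> \<open>The empty set has affine dimension -1, which \<open>nat\<close> sends to 0;
    without its exclusion it would be counted as a vertex.\<close>
  have "F \<noteq> {} \<and> nat (aff_dim F) = j \<longleftrightarrow> aff_dim F = int j" for F :: "'a set"
    using aff_dim_geq[of F] aff_dim_empty[of F] by (cases "F = {}") auto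
  then show ?thesis by (auto simp: nonempty_faces_def f_num_def intro!: arg_cong[where f = card])
qed

text \<open>Faces of dimension below that of \<open>P\<close> are automatically proper, and a proper
  face of a convex set has strictly smaller dimension. Only the empty set has weight 0.\<close>

lemma card_proper_faces:
  assumes "convex P" "P \<noteq> {}"
  shows "card {F \<in> proper_faces P. nat (aff_dim F + 1) = 0} = 1"
    and "int j < aff_dim P \<Longrightarrow> card {F \<in> proper_faces P. nat (aff_dim F + 1) = Suc j} = f_num j P"
    and "int j \<ge> aff_dim P \<Longrightarrow> card {F \<in> proper_faces P. nat (aff_dim F + 1) = Suc j} = 0"
proof -
  have "nat (aff_dim F + 1) = 0 \<longleftrightarrow> F = {}" for F :: "'a set"
    using aff_dim_geq[of F] aff_dim_empty[of F] by auto
  then have "{F \<in> proper_faces P. nat (aff_dim F + 1) = 0} = {{}}"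
    using assms(2) by (auto simp: proper_faces_def)
  then show "card {F \<in> proper_faces P. nat (aff_dim F + 1) = 0} = 1" by simp
  have *: "nat (aff_dim F + 1) = Suc j \<longleftrightarrow> aff_dim F = int j" for F :: "'a set" and j by auto
  show "card {F \<in> proper_faces P. nat (aff_dim F + 1) = Suc j} = f_num j P" if "int j < aff_dim P"
    unfolding * using that by (auto simp: proper_faces_def f_num_def intro!: arg_cong[where f = card])
  show "card {F \<in> proper_faces P. nat (aff_dim F + 1) = Suc j} = 0" if "int j \<ge> aff_dim P"
    unfolding * using that face_of_aff_dim_lt[OF assms(1)]
    by (fastforce simp: proper_faces_def card_eq_0_iff)
qed

lemma finite_nonempty_faces: "polytope P \<Longrightarrow> finite (nonempty_faces P)"
  and finite_proper_faces: "polytope P \<Longrightarrow> finite (proper_faces P)"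
  unfolding nonempty_faces_def proper_faces_def
  using finite_polytope_faces by (auto intro: finite_subset[rotated])

text \<open>With \<open>N = n + 3\<close>, the nonempty faces have generating polynomial
  \<open>N + N t + t^2\<close> and the proper ones \<open>1 + N t + N t^2\<close>. Division by
  \<open>N\<close> sends the single face of exceptional weight to 0 in each case.\<close>

lemma polygon_growth:
  assumes P: "\<And>n. polytope (P n)" "\<And>n. aff_dim (P n) = 2"
    and f: "\<And>n. f_num 0 (P n) = n + 3" "\<And>n. f_num 1 (P n) = n + 3"
  shows "graded_growth (\<lambda>n. nonempty_faces (P n)) (\<lambda>F. nat (aff_dim F)) 1 [:1, 1:]"
    and "graded_growth (\<lambda>n. proper_faces (P n)) (\<lambda>F. nat (aff_dim F + 1)) 1 [:0, 1, 1:]"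
proof -
  have conv: "convex (P n)" and ne: "P n \<noteq> {}" for n
    using P(1)[of n] P(2)[of n] polytope_imp_convex by auto
  have f2: "f_num 2 (P n) = 1" for n
  proof -
    have "{F. F face_of P n \<and> aff_dim F = 2} = {P n}"
      using face_of_aff_dim_lt[OF conv] P(2) face_of_refl[OF conv] by fastforce
    then show ?thesis by (simp add: f_num_def)
  qed
  have f3: "f_num (Suc (Suc (Suc j))) (P n) = 0" for n j
  proof -
    have "aff_dim F \<le> 2" if "F face_of P n" for F
      using aff_dim_subset[OF face_of_imp_subset[OF that]] P(2) by simp
    then have "{F. F face_of P n \<and> aff_dim F = int (Suc (Suc (Suc j)))} = {}" by fastforce
    then show ?thesis unfolding f_num_def by (simp only: card.empty)
  qed
  show "graded_growth (\<lambda>n. nonempty_faces (P n)) (\<lambda>F. nat (aff_dim F)) 1 [:1, 1:]"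
    unfolding graded_growth_def card_nonempty_faces
  proof (intro conjI allI)
    fix j
    consider "j = 0" | "j = 1" | "j = 2" | i where "j = Suc (Suc (Suc i))"
      by (metis One_nat_def numeral_2_eq_2 not0_implies_Suc)
    then show "(\<lambda>n. real (f_num j (P n)) / real (n + 3) ^ 1) \<longlonglongrightarrow> coeff [:1, 1:] j"
    proof cases
      case 1
      show ?thesis using growth_limits(1) by (simp only: 1 f) simp
    next
      case 2
      show ?thesis using growth_limits(1) by (simp only: 2 f) simp
    next
      case 3
      show ?thesis using growth_limits(2) by (simp only: 3 f2) (simp add: numeral_2_eq_2)
    next
      case 4
      show ?thesis by (simp only: 4 f3) simp
    qed
  qed (simp add: P finite_nonempty_faces)
  show "graded_growth (\<lambda>n. proper_faces (P n)) (\<lambda>F. nat (aff_dim F + 1)) 1 [:0, 1, 1:]"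
    unfolding graded_growth_def
  proof (intro conjI allI)
    fix j
    consider "j = 0" | "j = Suc 0" | "j = Suc 1" | i where "j = Suc i" "i \<ge> 2"
      by (cases j) force+
    then show "(\<lambda>n. real (card {F \<in> proper_faces (P n). nat (aff_dim F + 1) = j}) / real (n + 3) ^ 1)
        \<longlonglongrightarrow> coeff [:0, 1, 1:] j"
    proof cases
      case 1
      then show ?thesis
        unfolding 1 card_proper_faces(1)[OF conv ne] using growth_limits(2) by simp
    next
      case 2
      have "card {F \<in> proper_faces (P n). nat (aff_dim F + 1) = j} = n + 3" for n
        using card_proper_faces(2)[OF conv ne, of 0 n] unfolding 2 f P(2) by simp
      then show ?thesis using growth_limits(1) by (simp add: 2)
    next
      case 3
      have "card {F \<in> proper_faces (P n). nat (aff_dim F + 1) = j} = n + 3" for n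
        using card_proper_faces(2)[OF conv ne, of 1 n] unfolding 3 f P(2) by simp
      then show ?thesis using growth_limits(1) by (simp add: 3)
    next
      case 4
      have "card {F \<in> proper_faces (P n). nat (aff_dim F + 1) = j} = 0" for n
        using card_proper_faces(3)[OF conv ne, of n i] 4 P(2) by simp
      then show ?thesis using 4 by (simp add: coeff_pCons split: nat.split)
    qed
  qed (simp add: P finite_proper_faces)
qed

section \<open>Sums and free sums of polygons in mutually orthogonal planes\<close>

lemma subspace_split:
  fixes S :: "'a::euclidean_space set"
  assumes "subspace S" "dim S = a + b"
  obtains S' T where "subspace S'" "subspace T" "S' \<subseteq> S" "T \<subseteq> S" "dim S' = a" "dim T = b"
    "orthogonal_sets S' T"
proof -
  obtain S' where S': "subspace S'" "S' \<subseteq> span S" "dim S' = a"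
    using choose_subspace_of_subspace[of a S] assms(2) by auto
  let ?T = "{y \<in> S. \<forall>x\<in>S'. orthogonal x y}"
  have sub: "S' \<subseteq> S" using S'(2) span_eq_iff[THEN iffD2, OF assms(1)] by simp
  have "?T = S \<inter> {y. \<forall>x\<in>S'. orthogonal x y}" by auto
  then have "subspace ?T"
    using assms(1) subspace_inter[OF _ subspace_orthogonal_to_vectors] by metis
  moreover have "dim ?T = b"
    using dim_subspace_orthogonal_to_vectors[OF S'(1) assms(1) sub] S'(3) assms(2) by simp
  moreover have "orthogonal_sets S' ?T"
    by (auto simp: orthogonal_sets_def orthogonal_def)
  ultimately show ?thesis using that[of S' ?T] S' sub by auto
qed

lemma polygon_sequence:
  fixes T :: "'a::euclidean_space set"
  assumes "subspace T" "dim T = 2"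
  obtains P :: "nat \<Rightarrow> 'a set" where "\<And>n. polytope (P n)" "\<And>n. P n \<subseteq> T" "\<And>n. aff_dim (P n) = 2"
    "\<And>n. centered (P n)"
    "graded_growth (\<lambda>n. nonempty_faces (P n)) (\<lambda>F. nat (aff_dim F)) 1 [:1, 1:]"
    "graded_growth (\<lambda>n. proper_faces (P n)) (\<lambda>F. nat (aff_dim F + 1)) 1 [:0, 1, 1:]"
proof -
  have "\<forall>n. \<exists>P. polytope P \<and> P \<subseteq> T \<and> aff_dim P = 2 \<and> centered P \<and>
      f_num 0 P = n + 3 \<and> f_num 1 P = n + 3"
  proof
    fix n
    obtain P where "polytope P" "P \<subseteq> T" "aff_dim P = 2" "centered P"
      "card {F. F face_of P \<and> aff_dim F = 0} = n + 3" "card {F. F face_of P \<and> aff_dim F = 1} = n + 3"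
      by (rule polygon_exists[OF assms, of n])
    then show "\<exists>P. polytope P \<and> P \<subseteq> T \<and> aff_dim P = 2 \<and> centered P \<and>
      f_num 0 P = n + 3 \<and> f_num 1 P = n + 3" unfolding f_num_def by auto
  qed
  then obtain P where P: "\<And>n. polytope (P n)" "\<And>n. P n \<subseteq> T" "\<And>n. aff_dim (P n) = 2"
      "\<And>n. centered (P n)" "\<And>n. f_num 0 (P n) = n + 3" "\<And>n. f_num 1 (P n) = n + 3"
    by (auto dest!: choice)
  show ?thesis
    by (rule that[of P, OF P(1-4) polygon_growth[OF P(1,3,5,6)]])
qed

text \<open>A segment is a simplex, so its faces are the hulls of subsets of its endpoints.\<close>

lemma segment_faces:
  fixes v :: "'a::euclidean_space"
  assumes "v \<noteq> 0"
  shows "F face_of convex hull {- v, v} \<longleftrightarrow> F \<in> {{}, {- v}, {v}, convex hull {- v, v}}"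
proof -
  have "\<not> affine_dependent {- v, v}" by (rule affine_independent_2)
  then have "F face_of convex hull {- v, v} \<longleftrightarrow> F \<in> (\<lambda>c. convex hull c) ` Pow {- v, v}"
    by (subst face_of_convex_hull_affine_independent) auto
  also have "(\<lambda>c. convex hull c) ` Pow {- v, v} = {{}, {- v}, {v}, convex hull {- v, v}}"
    by (simp add: Pow_insert insert_commute)
  finally show ?thesis .
qed

text \<open>The start of both inductions: a point for \<open>e = 0\<close>, a segment centered at
  the origin for \<open>e = 1\<close>. The family is constant, so its exponent is 0 and the
  polynomials are exact.\<close>

lemma base_polytope:
  fixes S :: "'a::euclidean_space set"
  assumes "subspace S" "dim S = e" "e \<le> 1"
  obtains B where "polytope B" "B \<subseteq> S" "aff_dim B = int e" "centered B"
    "graded_growth (\<lambda>n. nonempty_faces B) (\<lambda>F. nat (aff_dim F)) 0 (if e = 0 then 1 else [:2, 1:])"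
    "graded_growth (\<lambda>n. proper_faces B) (\<lambda>F. nat (aff_dim F + 1)) 0 (if e = 0 then 1 else [:1, 2:])"
proof (cases "e = 0")
  case True
  have faces: "F face_of {0::'a} \<longleftrightarrow> F = {} \<or> F = {0}" for F
    using face_of_imp_subset[of F "{0}"] face_of_refl[of "{0::'a}"] by auto
  then have nf: "nonempty_faces {0::'a} = {{0}}" and pf: "proper_faces {0::'a} = {{}}"
    by (auto simp: nonempty_faces_def proper_faces_def)
  show ?thesis
  proof (rule that[of "{0}"])
    show "polytope {0::'a}" by (metis convex_hull_singleton finite.intros polytope_convex_hull)
    show "centered {0::'a}" by (auto simp: centered_def faces)
    show "graded_growth (\<lambda>n. nonempty_faces {0::'a}) (\<lambda>F. nat (aff_dim F)) 0 (if e = 0 then 1 else [:2, 1:])"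
      by (rule graded_growth_const) (auto simp: nf True Collect_conv_if)
    show "graded_growth (\<lambda>n. proper_faces {0::'a}) (\<lambda>F. nat (aff_dim F + 1)) 0 (if e = 0 then 1 else [:1, 2:])"
      by (rule graded_growth_const) (auto simp: pf True Collect_conv_if)
  qed (use True assms(1) in \<open>auto simp: subspace_0\<close>)
next
  case False
  then have e: "e = 1" using assms(3) by simp
  then obtain v where v: "v \<in> S" "v \<noteq> 0"
    using assms(2) dim_eq_0[of S] by auto
  let ?B = "convex hull {- v, v}"
  have neq: "- v \<noteq> v"
  proof
    assume "- v = v"
    then have "2 *\<^sub>R v = 0" by (metis add.right_inverse scaleR_2)
    with v(2) show False by simp
  qed
  have dimB: "aff_dim ?B = 1" using neq by (simp add: aff_dim_convex_hull)
  have B: "?B \<noteq> {}" "?B \<noteq> {v}" "?B \<noteq> {- v}" using dimB by auto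
  have nf: "nonempty_faces ?B = {{- v}, {v}, ?B}"
    using B by (auto simp: nonempty_faces_def segment_faces[OF v(2)])
  have pf: "proper_faces ?B = {{}, {- v}, {v}}"
    using B B[symmetric] by (auto simp: proper_faces_def segment_faces[OF v(2)])
  show ?thesis
  proof (rule that[of ?B])
    show "polytope ?B" by (simp add: polytope_convex_hull)
    show "?B \<subseteq> S"
      using v(1) assms(1) subspace_neg by (intro hull_minimal subspace_imp_convex) auto
    show "aff_dim ?B = int e" by (simp add: e dimB)
    have "(1/2) *\<^sub>R (- v) + (1/2) *\<^sub>R v \<in> ?B"
      by (intro convexD[OF convex_convex_hull] hull_inc) auto
    then show "centered ?B"
      using v(2) by (auto simp: centered_def segment_faces[OF v(2)])
    have "{F \<in> nonempty_faces ?B. nat (aff_dim F) = j} =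
        (if j = 0 then {{- v}, {v}} else if j = 1 then {?B} else {})" for j
      using dimB by (auto simp: nf)
    then show "graded_growth (\<lambda>n. nonempty_faces ?B) (\<lambda>F. nat (aff_dim F)) 0 (if e = 0 then 1 else [:2, 1:])"
      using neq by (intro graded_growth_const) (auto simp: nf e coeff_pCons split: nat.split)
    have "{F \<in> proper_faces ?B. nat (aff_dim F + 1) = j} =
        (if j = 0 then {{}} else if j = 1 then {{- v}, {v}} else {})" for j
      by (auto simp: pf)
    then show "graded_growth (\<lambda>n. proper_faces ?B) (\<lambda>F. nat (aff_dim F + 1)) 0 (if e = 0 then 1 else [:1, 2:])"
      using neq by (intro graded_growth_const) (auto simp: pf e coeff_pCons split: nat.split)
  qed
qed

text \<open>Induction on the number of polygons, splitting an orthogonal plane off \<open>S\<close>;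
  the subspace is generalized because the hypothesis is applied to the complement of that
  plane.\<close>

lemma polygon_sum_sequence:
  fixes S :: "'a::euclidean_space set"
  assumes "e \<le> 1" "subspace S" "dim S = e + 2 * m"
  shows "\<exists>P. (\<forall>n. polytope (P n) \<and> P n \<subseteq> S \<and> aff_dim (P n) = int (e + 2 * m)) \<and>
    graded_growth (\<lambda>n::nat. nonempty_faces (P n)) (\<lambda>F. nat (aff_dim F)) m
      ((if e = 0 then 1 else [:2, 1:]) * [:1, 1:] ^ m)"
  using assms(2,3)
proof (induction m arbitrary: S)
  case 0
  then obtain B where "polytope B" "B \<subseteq> S" "aff_dim B = int e"
    "graded_growth (\<lambda>n. nonempty_faces B) (\<lambda>F. nat (aff_dim F)) 0 (if e = 0 then 1 else [:2, 1:])"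
    using base_polytope[of S e] assms(1) by auto
  then show ?case by (intro exI[of _ "\<lambda>n. B"]) simp
next
  case (Suc m)
  have "dim S = (e + 2 * m) + 2" using Suc.prems by simp
  then obtain S' T where ST: "subspace S'" "subspace T" "S' \<subseteq> S" "T \<subseteq> S" "dim S' = e + 2 * m" "dim T = 2"
    and orth: "orthogonal_sets S' T"
    by (rule subspace_split[OF Suc.prems(1)])
  obtain P where P: "\<And>n. polytope (P n)" "\<And>n. P n \<subseteq> S'" "\<And>n. aff_dim (P n) = int (e + 2 * m)"
    and gP: "graded_growth (\<lambda>n::nat. nonempty_faces (P n)) (\<lambda>F. nat (aff_dim F)) m
      ((if e = 0 then 1 else [:2, 1:]) * [:1, 1:] ^ m)"
    using Suc.IH[OF ST(1,5)] by auto
  obtain Q where Q: "\<And>n. polytope (Q n)" "\<And>n. Q n \<subseteq> T" "\<And>n. aff_dim (Q n) = 2"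
    and gQ: "graded_growth (\<lambda>n::nat. nonempty_faces (Q n)) (\<lambda>F. nat (aff_dim F)) 1 [:1, 1:]"
    using polygon_sequence[OF ST(2,6)] by metis
  have ne: "P n \<noteq> {}" "Q n \<noteq> {}" for n
    using P(3)[of n] Q(3)[of n] by auto
  have "graded_growth (\<lambda>n. nonempty_faces (set_sum (P n) (Q n))) (\<lambda>F. nat (aff_dim F)) (m + 1)
      ((if e = 0 then 1 else [:2, 1:]) * [:1, 1:] ^ m * [:1, 1:])"
  proof (rule graded_growth_product[OF gP gQ])
    show "bij_betw (\<lambda>(F, G). set_sum F G) (nonempty_faces (P n) \<times> nonempty_faces (Q n))
        (nonempty_faces (set_sum (P n) (Q n)))" for n
      unfolding nonempty_faces_def
      by (rule bij_betw_faces_set_sum[OF P(1,2) ST(1) Q(1,2) ST(2) orth])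
    fix n F G assume FG: "F \<in> nonempty_faces (P n)" "G \<in> nonempty_faces (Q n)"
    then have "F \<subseteq> S'" "G \<subseteq> T" "F \<noteq> {}" "G \<noteq> {}"
      using P(2) Q(2) face_of_imp_subset by (fastforce simp: nonempty_faces_def)+
    then have "aff_dim (set_sum F G) = aff_dim F + aff_dim G" "aff_dim F \<ge> 0" "aff_dim G \<ge> 0"
      using aff_dim_set_sum_orthogonal[OF ST(1,2) orth, of F G] aff_dim_negative_iff[of F]
        aff_dim_negative_iff[of G] by linarith+
    \<comment> \<open>Nonempty faces have nonnegative dimension, so \<open>nat\<close> is additive
      here.\<close>
    then show "nat (aff_dim (case (F, G) of (F, G) \<Rightarrow> set_sum F G)) = nat (aff_dim F) + nat (aff_dim G)"
      by (simp add: nat_add_distrib)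
  qed
  then have growth: "graded_growth (\<lambda>n. nonempty_faces (set_sum (P n) (Q n))) (\<lambda>F. nat (aff_dim F))
      (Suc m) ((if e = 0 then 1 else [:2, 1:]) * [:1, 1:] ^ Suc m)"
    by (simp only: Suc_eq_plus1[symmetric] power_Suc2 mult.assoc)
  have poly: "polytope (set_sum (P n) (Q n))" for n
    by (intro polytope_set_sum P Q)
  have sub: "set_sum (P n) (Q n) \<subseteq> S" for n
  proof
    fix z assume "z \<in> set_sum (P n) (Q n)"
    then obtain x y where "x \<in> P n" "y \<in> Q n" "z = x + y" by (rule set_sumE)
    then show "z \<in> S"
      using P(2)[of n] Q(2)[of n] ST(3,4) by (auto intro!: subspace_add[OF Suc.prems(1)])
  qed
  have dim: "aff_dim (set_sum (P n) (Q n)) = int (e + 2 * Suc m)" for n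
    using aff_dim_set_sum_orthogonal[OF ST(1,2) orth P(2) Q(2) ne] P(3) Q(3) by simp
  show ?case
    by (intro exI[of _ "\<lambda>n. set_sum (P n) (Q n)"] conjI allI poly sub dim growth)
qed

text \<open>The same induction with joins. Centeredness is carried along because the face
  correspondence of a free sum requires it of both summands.\<close>

lemma polygon_free_sum_sequence:
  fixes S :: "'a::euclidean_space set"
  assumes "e \<le> 1" "subspace S" "dim S = e + 2 * m"
  shows "\<exists>P. (\<forall>n. polytope (P n) \<and> P n \<subseteq> S \<and> aff_dim (P n) = int (e + 2 * m) \<and> centered (P n)) \<and>
    graded_growth (\<lambda>n::nat. proper_faces (P n)) (\<lambda>F. nat (aff_dim F + 1)) m
      ((if e = 0 then 1 else [:1, 2:]) * [:0, 1, 1:] ^ m)"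
  using assms(2,3)
proof (induction m arbitrary: S)
  case 0
  then obtain B where "polytope B" "B \<subseteq> S" "aff_dim B = int e" "centered B"
    "graded_growth (\<lambda>n. proper_faces B) (\<lambda>F. nat (aff_dim F + 1)) 0 (if e = 0 then 1 else [:1, 2:])"
    using base_polytope[of S e] assms(1) by auto
  then show ?case by (intro exI[of _ "\<lambda>n. B"]) simp
next
  case (Suc m)
  have "dim S = (e + 2 * m) + 2" using Suc.prems by simp
  then obtain S' T where ST: "subspace S'" "subspace T" "S' \<subseteq> S" "T \<subseteq> S" "dim S' = e + 2 * m" "dim T = 2"
    and orth: "orthogonal_sets S' T"
    by (rule subspace_split[OF Suc.prems(1)])
  obtain P where P: "\<And>n. polytope (P n)" "\<And>n. P n \<subseteq> S'" "\<And>n. aff_dim (P n) = int (e + 2 * m)"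
      "\<And>n. centered (P n)"
    and gP: "graded_growth (\<lambda>n::nat. proper_faces (P n)) (\<lambda>F. nat (aff_dim F + 1)) m
      ((if e = 0 then 1 else [:1, 2:]) * [:0, 1, 1:] ^ m)"
    using Suc.IH[OF ST(1,5)] by auto
  obtain Q where Q: "\<And>n. polytope (Q n)" "\<And>n. Q n \<subseteq> T" "\<And>n. aff_dim (Q n) = 2" "\<And>n. centered (Q n)"
    and gQ: "graded_growth (\<lambda>n::nat. proper_faces (Q n)) (\<lambda>F. nat (aff_dim F + 1)) 1 [:0, 1, 1:]"
    using polygon_sequence[OF ST(2,6)] by metis
  have 0: "0 \<in> P n" "0 \<in> Q n" for n
    using P(4) Q(4) by (auto simp: centered_def)
  let ?R = "\<lambda>n. convex hull (P n \<union> Q n)"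
  have "graded_growth (\<lambda>n. proper_faces (?R n)) (\<lambda>F. nat (aff_dim F + 1)) (m + 1)
      ((if e = 0 then 1 else [:1, 2:]) * [:0, 1, 1:] ^ m * [:0, 1, 1:])"
  proof (rule graded_growth_product[OF gP gQ])
    show "bij_betw (\<lambda>(F, G). convex hull (F \<union> G)) (proper_faces (P n) \<times> proper_faces (Q n))
        (proper_faces (?R n))" for n
      unfolding proper_faces_def
      by (rule bij_betw_faces_free_sum[OF P(1,2) ST(1) P(4) Q(1,2) ST(2) Q(4) orth])
    fix n F G assume "F \<in> proper_faces (P n)" "G \<in> proper_faces (Q n)"
    then have "aff_dim (convex hull (F \<union> G)) + 1 = (aff_dim F + 1) + (aff_dim G + 1)"
      unfolding proper_faces_def
      by (intro proper_face_free_sum(4)[OF P(1,2) ST(1) P(4) Q(1,2) ST(2) Q(4) orth, of F n G n]) auto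
    \<comment> \<open>Affine dimensions are at least -1, so both shifted dimensions are nonnegative
      and \<open>nat\<close> is additive.\<close>
    then show "nat (aff_dim (case (F, G) of (F, G) \<Rightarrow> convex hull (F \<union> G)) + 1) =
        nat (aff_dim F + 1) + nat (aff_dim G + 1)"
      using aff_dim_geq[of F] aff_dim_geq[of G] by simp
  qed
  then have growth: "graded_growth (\<lambda>n. proper_faces (?R n)) (\<lambda>F. nat (aff_dim F + 1))
      (Suc m) ((if e = 0 then 1 else [:1, 2:]) * [:0, 1, 1:] ^ Suc m)"
    by (simp only: Suc_eq_plus1[symmetric] power_Suc2 mult.assoc)
  have poly: "polytope (?R n)" and cent: "centered (?R n)" for n
    by (intro polytope_free_sum centered_free_sum P Q)+
  have sub: "?R n \<subseteq> S" for n
    using P(2)[of n] Q(2)[of n] ST(3,4)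
    by (intro hull_minimal subspace_imp_convex[OF Suc.prems(1)]) auto
  have dim: "aff_dim (?R n) = int (e + 2 * Suc m)" for n
    using aff_dim_free_sum[OF P(2) ST(1) 0(1) Q(2) ST(2) 0(2) orth] P(3) Q(3) by simp
  show ?case
    by (intro exI[of _ ?R] conjI allI poly sub dim cent growth)
qed

section \<open>Coefficients of the limiting polynomials and their relation to
  \<open>rho\<close>\<close>

lemma coeff_one_plus_X_power: "coeff ([:1, 1:] ^ m :: real poly) k = real (m choose k)"
  by (cases "k \<le> m") (simp_all add: coeff_linear_poly_power coeff_eq_0 degree_linear_power)

text \<open>The polynomial is \<open>t^m (1 + t)^m\<close>; binomial symmetry brings the lower index
  into the form that \<open>rho d (d - k - 1)\<close> needs. The case split matters since truncated
  subtraction would give the value 1 for \<open>j > 2 * m\<close>.\<close>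

lemma coeff_X_plus_X2_power:
  "coeff ([:0, 1, 1:] ^ m :: real poly) j = (if j \<le> 2 * m then real (m choose (2 * m - j)) else 0)"
proof -
  have "[:0, 1, 1:] = monom 1 1 * ([:1, 1:] :: real poly)"
    by (simp add: monom_altdef)
  then have "[:0, 1, 1:] ^ m = monom 1 m * ([:1, 1:] ^ m :: real poly)"
    by (simp only: power_mult_distrib monom_power) simp
  then have eq: "coeff ([:0, 1, 1:] ^ m :: real poly) j = (if j < m then 0 else real (m choose (j - m)))"
    by (simp add: coeff_monom_mult coeff_one_plus_X_power)
  show ?thesis
  proof (cases "m \<le> j \<and> j \<le> 2 * m")
    case True
    then have "m choose (j - m) = m choose (2 * m - j)"
      using binomial_symmetric[of "j - m" m] by (simp add: mult_2 le_diff_conv)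
    with True eq show ?thesis by simp
  qed (use eq in auto)
qed

lemma rho_eq:
  assumes "e \<le> 1"
  shows "rho (e + 2 * m) k = (real (m + e choose k) + real (m choose k)) / 2"
proof -
  have "nat \<lceil>real (e + 2 * m) / 2\<rceil> = m + e"
    using assms by (cases "e = 0") (auto simp: ceiling_unique le_Suc_eq intro!: nat_eq_iff[THEN iffD2])
  moreover have "nat \<lfloor>real (e + 2 * m) / 2\<rfloor> = m"
    using floor_divide_of_nat_eq[of "e + 2 * m" 2, where 'a = real] assms by simp
  ultimately show ?thesis by (simp add: rho_def)
qed

text \<open>The constant term is \<open>2^e\<close>. For \<open>e = 1\<close>, coefficient
  \<open>k\<close> is \<open>2 C(m, k) + C(m, k - 1)\<close>, which Pascal's rule turns into
  \<open>C(m, k) + C(m + 1, k)\<close>.\<close>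

lemma coeff_ratio_sum:
  fixes e m k :: nat
  assumes "e \<le> 1"
  defines "p \<equiv> (if e = 0 then 1 else [:2, 1:]) * ([:1, 1:] ^ m :: real poly)"
  shows "coeff p 0 \<noteq> 0" "coeff p k / coeff p 0 = rho (e + 2 * m) k"
proof -
  have "coeff p 0 \<noteq> 0 \<and> coeff p k / coeff p 0 = rho (e + 2 * m) k"
  proof (cases "e = 0")
    case True
    then show ?thesis
      unfolding rho_eq[OF assms(1)] by (simp add: p_def coeff_one_plus_X_power)
  next
    case False
    then have e: "e = 1" using assms(1) by simp
    show ?thesis
      unfolding rho_eq[OF assms(1)]
      by (cases k) (simp_all add: p_def e coeff_one_plus_X_power)
  qed
  then show "coeff p 0 \<noteq> 0" "coeff p k / coeff p 0 = rho (e + 2 * m) k" by auto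
qed

text \<open>The denominator is the leading coefficient \<open>2^e\<close>. For \<open>e = 1\<close>,
  Pascal's rule again combines the two binomials of the numerator, now with lower indices
  \<open>2 m - k\<close> and \<open>2 m - k - 1\<close>.\<close>

lemma coeff_ratio_free_sum:
  fixes e m k :: nat
  assumes "e \<le> 1" "k < e + 2 * m"
  defines "p \<equiv> (if e = 0 then 1 else [:1, 2:]) * ([:0, 1, 1:] ^ m :: real poly)"
  shows "coeff p (e + 2 * m) \<noteq> 0"
    "coeff p (Suc k) / coeff p (e + 2 * m) = rho (e + 2 * m) (e + 2 * m - k - 1)"
proof -
  have "coeff p (e + 2 * m) \<noteq> 0 \<and>
    coeff p (Suc k) / coeff p (e + 2 * m) = rho (e + 2 * m) (e + 2 * m - k - 1)"
  proof (cases "e = 0")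
    case True
    with assms(2) show ?thesis
      unfolding rho_eq[OF assms(1)] by (simp add: p_def coeff_X_plus_X2_power)
  next
    case False
    then have e: "e = 1" using assms(1) by simp
    show ?thesis
    proof (cases "k = 2 * m")
      case True
      then show ?thesis
        unfolding rho_eq[OF assms(1)] by (simp add: p_def e coeff_X_plus_X2_power coeff_pCons)
    next
      case False
      then obtain l where "2 * m - k = Suc l" "2 * m - Suc k = l" "k < 2 * m"
        using assms(2) e by (metis Suc_diff_Suc less_SucE plus_1_eq_Suc)
      then show ?thesis
        unfolding rho_eq[OF assms(1)] by (simp add: p_def e coeff_X_plus_X2_power coeff_pCons)
    qed
  qed
  then show "coeff p (e + 2 * m) \<noteq> 0"
    "coeff p (Suc k) / coeff p (e + 2 * m) = rho (e + 2 * m) (e + 2 * m - k - 1)" by auto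
qed

theorem theorem3p2:
  fixes d k :: nat
  assumes "0 < d" and "k \<le> d - 1"
    and "d \<le> DIM('a::euclidean_space)"
  shows "\<exists>(P :: nat \<Rightarrow> 'a set) (Q :: nat \<Rightarrow> 'a set).
           (\<forall>n. d_polytope d (P n)) \<and> (\<forall>n. d_polytope d (Q n)) \<and>
           (\<forall>\<epsilon>>0. \<forall>\<^sub>F n in sequentially.
              real (f_num k (P n)) / real (f_num 0 (P n)) < rho d k + \<epsilon> \<and>
              real (f_num k (Q n)) / real (f_num (d - 1) (Q n)) < rho d (d - k - 1) + \<epsilon>)"
proof -
  define e m where "e = d mod 2" and "m = d div 2"
  have d: "d = e + 2 * m" and e: "e \<le> 1" by (auto simp: e_def m_def)
  \<comment> \<open>Both constructions take place in one \<open>d\<close>-dimensional subspace of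
    the ambient space.\<close>
  obtain S :: "'a set" where S: "subspace S" "dim S = d"
    using choose_subspace_of_subspace[of d "UNIV :: 'a set"] assms(3) by (auto simp: dim_UNIV)
  obtain P :: "nat \<Rightarrow> 'a set" where P: "\<And>n. polytope (P n)" "\<And>n. aff_dim (P n) = int d"
    and gP: "graded_growth (\<lambda>n. nonempty_faces (P n)) (\<lambda>F. nat (aff_dim F)) m
      ((if e = 0 then 1 else [:2, 1:]) * [:1, 1:] ^ m)"
    using polygon_sum_sequence[OF e S(1) S(2)[unfolded d]] unfolding d[symmetric] by metis
  obtain Q :: "nat \<Rightarrow> 'a set" where Q: "\<And>n. polytope (Q n)" "\<And>n. aff_dim (Q n) = int d"
    and gQ: "graded_growth (\<lambda>n. proper_faces (Q n)) (\<lambda>F. nat (aff_dim F + 1)) m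
      ((if e = 0 then 1 else [:1, 2:]) * [:0, 1, 1:] ^ m)"
    using polygon_free_sum_sequence[OF e S(1) S(2)[unfolded d]] unfolding d[symmetric] by metis
  have k: "k < e + 2 * m" using assms(1,2) d by linarith
  have limP: "(\<lambda>n. real (f_num k (P n)) / real (f_num 0 (P n))) \<longlonglongrightarrow> rho d k"
    using graded_growth_ratio[OF gP coeff_ratio_sum(1)[OF e], of k]
    unfolding card_nonempty_faces coeff_ratio_sum(2)[OF e] d[symmetric] .
  have ne: "Q n \<noteq> {}" for n using Q(2)[of n] assms(1) by auto
  have fQ: "card {F \<in> proper_faces (Q n). nat (aff_dim F + 1) = Suc j} = f_num j (Q n)" if "j < d" for j n
    using card_proper_faces(2)[OF polytope_imp_convex[OF Q(1)] ne] Q(2) that by simp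
  \<comment> \<open>Facets have dimension \<open>d - 1\<close>, hence weight \<open>d\<close> in the
    shifted grading.\<close>
  have "Suc (d - 1) = e + 2 * m" using assms(1) d by linarith
  with fQ[of "d - 1"] have facets:
    "card {F \<in> proper_faces (Q n). nat (aff_dim F + 1) = e + 2 * m} = f_num (d - 1) (Q n)" for n
    using assms(1) by simp
  have limQ: "(\<lambda>n. real (f_num k (Q n)) / real (f_num (d - 1) (Q n))) \<longlonglongrightarrow> rho d (d - k - 1)"
    using graded_growth_ratio[OF gQ coeff_ratio_free_sum(1)[OF e k], of "Suc k"]
    unfolding coeff_ratio_free_sum(2)[OF e k] facets fQ[OF k[folded d]] unfolding d[symmetric] .
  \<comment> \<open>Both quotients converge to the respective value of \<open>rho\<close>, which
    bounds them eventually by that value plus any positive amount.\<close>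
  have "\<forall>\<^sub>F n in sequentially.
      real (f_num k (P n)) / real (f_num 0 (P n)) < rho d k + \<epsilon> \<and>
      real (f_num k (Q n)) / real (f_num (d - 1) (Q n)) < rho d (d - k - 1) + \<epsilon>" if "\<epsilon> > 0" for \<epsilon>
    using order_tendstoD(2)[OF limP, of "rho d k + \<epsilon>"]
      order_tendstoD(2)[OF limQ, of "rho d (d - k - 1) + \<epsilon>"] that
    by (simp add: eventually_conj)
  then show ?thesis
    using P Q by (intro exI[of _ P] exI[of _ Q]) (simp add: d_polytope_def)
qed

end
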